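(* Let $X\in\{0,\pm1\}^{n\times n}$ be symmetric. Then the following statements are equivalent: (i) $\operatorname{diag}(X)=\mathbf 1_n$, $\operatorname{rank}(X)=r$, $X\succeq\mathbf 0$. (ii) There exists a permutation matrix $Q$ such that $QXQ^\top=\mathbf B_{n_1}\oplus\cdots\oplus\mathbf B_{n_r}$, where $\mathbf B_{n_i}=b_ib_i^\top$ with $b_i\in\{\pm1\}^{n_i}$ for $i\in[r]$, and $n=n_1+\dots+n_r$ (with $n_1,\dots,n_r$ positive integers).
   Context: $\oplus$ denotes the direct sum of matrices (block diagonal matrix); $\operatorname{diag}(X)$ is the vector of diagonal entries; $\mathbf 1_n$ is the all-ones vector; $X\succeq\mathbf 0$ means positive semidefinite; $[r]=\{1,\dots,r\}$. *)

theory Defs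
  imports "HOL.Real" "HOL-Combinatorics.Permutations" "Jordan_Normal_Form.DL_Rank"
begin

definition symmetric_matrix :: "'a mat \<Rightarrow> bool" where
  "symmetric_matrix A \<longleftrightarrow> transpose_mat A = A"

definition positive_semidefinite :: "real mat \<Rightarrow> bool" where
  "positive_semidefinite A \<longleftrightarrow>
     symmetric_matrix A \<and> (\<forall>v \<in> carrier_vec (dim_row A). 0 \<le> v \<bullet> (A *\<^sub>v v))"

definition permutation_matrix :: "nat \<Rightarrow> 'a :: zero_neq_one mat \<Rightarrow> bool" where
  "permutation_matrix n Q \<longleftrightarrow>
     (\<exists>\<pi>. \<pi> permutes {..<n} \<and> Q = mat n n (\<lambda>(i, j). if j = \<pi> i then 1 else 0))"

definition outer_product :: "'a :: times vec \<Rightarrow> 'a vec \<Rightarrow> 'a mat" where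
  "outer_product u v = mat (dim_vec u) (dim_vec v) (\<lambda>(i, j). u $ i * v $ j)"

end

(* In a positive semidefinite matrix with unit diagonal, an entry X_ij = 1 or -1 makes e_i - X_ij e_j
   isotropic, hence a kernel vector, so column i is X_ij times column j. Hence X_ij nonzero is
   an equivalence relation on the indices, and fixing one representative per class gives signs s with
   X_ij = s_i s_j inside a class and 0 across classes. The number of classes is the rank: X is a sum
   of one rank-one matrix per class, and the submatrix on a set of representatives is the identity.
   Sorting the indices by class produces the block diagonal form. *)

theory Submission
  imports Defs "Jordan_Normal_Form.DL_Rank_Submatrix"
begin

text \<open>The values of \<open>f\<close> are the labels of the \<open>r\<close> blocks, which need not be contiguous; the image condition
  makes all of them nonempty.\<close>

definition signed_partition ::
  "nat \<Rightarrow> nat \<Rightarrow> (nat \<Rightarrow> nat) \<Rightarrow> (nat \<Rightarrow> real) \<Rightarrow> real mat \<Rightarrow> bool" where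
  "signed_partition n r f s A \<longleftrightarrow>
     A \<in> carrier_mat n n \<and> f ` {..<n} = {..<r} \<and> (\<forall>i<n. s i \<in> {-1, 1}) \<and>
     (\<forall>i<n. \<forall>j<n. A $$ (i, j) = (if f i = f j then s i * s j else 0))"

section \<open>Diagonal, definiteness and rank of a signed partition matrix\<close>

lemma signed_partition_diag:
  assumes "signed_partition n r f s A"
  shows "diag_mat A = replicate n 1"
proof (rule nth_equalityI)
  show "length (diag_mat A) = length (replicate n (1::real))"
    using assms by (auto simp: signed_partition_def diag_mat_def)
next
  fix i assume "i < length (diag_mat A)"
  then have "i < n" using assms by (auto simp: signed_partition_def diag_mat_def)
  moreover from this have "s i * s i = 1" using assms by (auto simp: signed_partition_def)
  ultimately show "diag_mat A ! i = replicate n 1 ! i"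
    using assms by (auto simp: signed_partition_def diag_mat_def)
qed

text \<open>Only the summand \<open>k = f i\<close> can survive. This form exhibits \<open>A\<close>
  as a sum of \<open>r\<close> rank-one matrices, which serves both semidefiniteness and the upper
  bound on the rank.\<close>

lemma signed_partition_indicator_sum:
  assumes "signed_partition n r f s A" "i < n" "j < n"
  shows "A $$ (i, j) =
    (\<Sum>k<r. (if f i = k then s i else 0) * (if f j = k then s j else 0))"
proof -
  have "f i < r" using assms by (auto simp: signed_partition_def)
  have "(\<Sum>k<r. (if f i = k then s i else 0) * (if f j = k then s j else 0))
      = (\<Sum>k<r. if k = f i then (if f j = f i then s i * s j else 0) else 0)"
    by (rule sum.cong) auto
  also have "\<dots> = (if f j = f i then s i * s j else 0)"
    using \<open>f i < r\<close> by simp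
  finally show ?thesis using assms by (auto simp: signed_partition_def)
qed

lemma scalar_prod_mult_mat_vec:
  fixes v :: "real vec"
  assumes "A \<in> carrier_mat n n" "v \<in> carrier_vec n"
  shows "v \<bullet> (A *\<^sub>v v) = (\<Sum>i<n. \<Sum>j<n. v $ i * A $$ (i, j) * v $ j)"
proof -
  have "v \<bullet> (A *\<^sub>v v) = (\<Sum>i<n. v $ i * (\<Sum>j<n. A $$ (i, j) * v $ j))"
    using assms by (auto simp: scalar_prod_def atLeast0LessThan intro!: sum.cong)
  then show ?thesis by (simp add: sum_distrib_left mult.assoc)
qed

text \<open>Splitting each entry over the labels and pulling that sum outside turns the quadratic
  form into a sum of \<open>r\<close> squares.\<close>

lemma signed_partition_positive_semidefinite:
  assumes "signed_partition n r f s A"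
  shows "positive_semidefinite A"
  unfolding positive_semidefinite_def
proof (intro conjI ballI)
  have A: "A \<in> carrier_mat n n" using assms by (simp add: signed_partition_def)
  show "symmetric_matrix A"
    unfolding symmetric_matrix_def
    using assms by (intro eq_matI) (auto simp: signed_partition_def)
  fix v :: "real vec" assume "v \<in> carrier_vec (dim_row A)"
  then have v: "v \<in> carrier_vec n" using A by simp
  let ?e = "\<lambda>k i. if f i = k then s i else 0"
  have "v \<bullet> (A *\<^sub>v v) = (\<Sum>i<n. \<Sum>j<n. \<Sum>k<r. (v $ i * ?e k i) * (v $ j * ?e k j))"
    unfolding scalar_prod_mult_mat_vec[OF A v]
    by (intro sum.cong refl)
      (simp add: signed_partition_indicator_sum[OF assms] sum_distrib_left sum_distrib_right mult_ac)
  also have "\<dots> = (\<Sum>k<r. \<Sum>i<n. \<Sum>j<n. (v $ i * ?e k i) * (v $ j * ?e k j))"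
    by (subst sum.swap[of _ "{..<r}"], subst sum.swap[of _ "{..<r}"]) simp
  also have "\<dots> = (\<Sum>k<r. (\<Sum>i<n. v $ i * ?e k i)\<^sup>2)"
    by (simp add: power2_eq_square sum_product)
  finally show "0 \<le> v \<bullet> (A *\<^sub>v v)" by (simp add: sum_nonneg)
qed

text \<open>By subadditivity, each further product term raises the rank by at most one.\<close>

lemma rank_sum_products_le:
  fixes u w :: "nat \<Rightarrow> nat \<Rightarrow> 'a :: field"
  shows "vec_space.rank n (mat n nc (\<lambda>(i, j). \<Sum>k<r. u k i * w k j)) \<le> r"
proof (induction r)
  case 0
  have "mat n nc (\<lambda>(i, j). \<Sum>k<0. u k i * w k j) = 0\<^sub>m n nc" by (intro eq_matI) auto
  then show ?case using vec_space.rank_0I[where 'a='a] by (metis le0)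
next
  case (Suc r)
  let ?A = "mat n nc (\<lambda>(i, j). \<Sum>k<r. u k i * w k j)"
  let ?B = "mat n nc (\<lambda>(i, j). u r i * w r j)"
  have "mat n nc (\<lambda>(i, j). \<Sum>k<Suc r. u k i * w k j) = ?A + ?B"
    by (intro eq_matI) auto
  moreover have "vec_space.rank n (?A + ?B) \<le> vec_space.rank n ?A + vec_space.rank n ?B"
    by (rule vec_space.rank_subadditive) auto
  moreover have "vec_space.rank n ?B \<le> 1"
    by (rule vec_space.rank_le_1_product_entries) auto
  ultimately show ?case using Suc by simp
qed

lemma signed_partition_rank:
  assumes "signed_partition n r f s A"
  shows "vec_space.rank n A = r"
proof (rule antisym)
  have A: "A \<in> carrier_mat n n" using assms by (simp add: signed_partition_def)
  have "A = mat n n (\<lambda>(i, j).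
      \<Sum>k<r. (if f i = k then s i else 0) * (if f j = k then s j else 0))"
    using A by (intro eq_matI) (auto simp: signed_partition_indicator_sum[OF assms])
  then show "vec_space.rank n A \<le> r"
    using rank_sum_products_le
      [of n n "\<lambda>k i. if f i = k then s i else 0" "\<lambda>k j. if f j = k then s j else 0" r]
    by simp
next
  have A: "A \<in> carrier_mat n n" using assms by (simp add: signed_partition_def)
  \<comment> \<open>For the lower bound, \<open>J\<close> picks one index per label, so its
    principal submatrix is an \<open>r\<close> by \<open>r\<close> minor.\<close>
  obtain J where J: "J \<subseteq> {..<n}" "inj_on f J" "f ` J = {..<r}"
    using assms subset_image_inj[of "{..<r}" f "{..<n}"]
    by (auto simp: signed_partition_def)
  have JJ: "{j. j < n \<and> j \<in> J} = J" using J by auto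
  have card: "card J = r" using J card_image by fastforce
  have "submatrix A J J = 1\<^sub>m r"
  proof (rule eq_matI)
    fix i j assume "i < dim_row (1\<^sub>m r :: real mat)" "j < dim_col (1\<^sub>m r :: real mat)"
    then have ij: "i < r" "j < r" by auto
    let ?p = "pick J i" and ?q = "pick J j"
    have pq: "?p \<in> J" "?q \<in> J" using ij card by (auto intro!: pick_in_set_le)
    then have lt: "?p < n" "?q < n" using J by auto
    \<comment> \<open>\<open>pick J\<close> is strictly increasing, and \<open>f\<close> is
      injective on \<open>J\<close>: distinct positions carry distinct labels, so all off-diagonal
      entries vanish.\<close>
    have "?p = ?q \<longleftrightarrow> i = j" using ij card
      by (metis linorder_neqE_nat less_irrefl pick_mono_le)
    then have "f ?p = f ?q \<longleftrightarrow> i = j" using pq J(2) by (metis inj_onD)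
    moreover have "s ?p * s ?p = 1" using assms lt by (auto simp: signed_partition_def)
    ultimately have "A $$ (?p, ?q) = 1\<^sub>m r $$ (i, j)"
      using assms lt ij by (auto simp: signed_partition_def)
    then show "submatrix A J J $$ (i, j) = 1\<^sub>m r $$ (i, j)"
      using A ij JJ card by (simp add: submatrix_def)
  qed (use A JJ card in \<open>auto simp: dim_submatrix\<close>)
  then have "det (submatrix A J J) \<noteq> 0" by simp
  from vec_space.rank_gt_minor[OF A this] show "r \<le> vec_space.rank n A"
    by (simp add: JJ card)
qed

section \<open>Block diagonal form and permutation of indices\<close>

text \<open>Induction on \<open>ks\<close>, with list elements of arbitrary type so that both
  directions can use it: once with indices grouped by class, once with pairs of a block and an
  offset.\<close>

lemma diag_block_mat_outer_products:
  assumes "distinct ks" "\<And>k x. k \<in> set ks \<Longrightarrow> x \<in> set (L k) \<Longrightarrow> f x = k"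
  defines "xs \<equiv> concat (map L ks)"
  shows "diag_block_mat (map (\<lambda>k. outer_product (vec (length (L k)) (\<lambda>i. s (L k ! i)))
                                     (vec (length (L k)) (\<lambda>i. s (L k ! i)))) ks)
    = mat (length xs) (length xs)
        (\<lambda>(i, j). if f (xs ! i) = f (xs ! j) then s (xs ! i) * s (xs ! j) else (0 :: 'a :: mult_zero))"
  using assms(1,2) unfolding xs_def
proof (induction ks)
  case Nil
  then show ?case by (intro eq_matI) auto
next
  case (Cons k ks)
  define ys where "ys = concat (map L ks)"
  define B where "B k = outer_product (vec (length (L k)) (\<lambda>i. s (L k ! i)))
    (vec (length (L k)) (\<lambda>i. s (L k ! i)))" for k
  have B_index: "B k $$ (i, j) = s (L k ! i) * s (L k ! j)"
    if "i < length (L k)" "j < length (L k)" for i j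
    using that by (simp add: B_def outer_product_def)
  have B_dim: "dim_row (B k) = length (L k)" "dim_col (B k) = length (L k)"
    by (simp_all add: B_def outer_product_def)
  have f_L: "f (L k ! i) = k" if "i < length (L k)" for i
    using that Cons.prems by auto
  have f_ys: "f (ys ! i) \<noteq> k" if "i < length ys" for i
  proof -
    have "ys ! i \<in> set ys" using that by (rule nth_mem)
    then obtain k' where "k' \<in> set ks" "ys ! i \<in> set (L k')" by (auto simp: ys_def)
    moreover from this have "f (ys ! i) = k'" using Cons.prems(2) by simp
    ultimately show ?thesis using Cons.prems(1) by auto
  qed
  have "diag_block_mat (map B ks) = mat (length ys) (length ys)
      (\<lambda>(i, j). if f (ys ! i) = f (ys ! j) then s (ys ! i) * s (ys ! j) else 0)"
    unfolding B_def ys_def using Cons.prems by (intro Cons.IH) auto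
  then have "diag_block_mat (map B (k # ks)) = mat (length (L k @ ys)) (length (L k @ ys))
      (\<lambda>(i, j). if f ((L k @ ys) ! i) = f ((L k @ ys) ! j)
        then s ((L k @ ys) ! i) * s ((L k @ ys) ! j) else 0)"
    \<comment> \<open>The two off-diagonal blocks test the labels in opposite orders, so the
      inequality is supplied both ways round.\<close>
    using f_ys f_ys[THEN not_sym]
    by (intro eq_matI) (auto simp: Let_def B_index B_dim nth_append f_L)
  then show ?case by (simp only: B_def[abs_def] ys_def list.map concat.simps)
qed

text \<open>Row \<open>i\<close> of \<open>Q\<close> is the unit vector at \<open>\<pi> i\<close>,
  so each multiplication collapses to a single summand.\<close>

lemma permutation_matrix_conj:
  assumes "\<pi> permutes {..<n}" "A \<in> carrier_mat n n"
    and "Q = mat n n (\<lambda>(i, j). if j = \<pi> i then 1 else (0 :: 'a :: comm_ring_1))"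
  shows "Q * A * transpose_mat Q = mat n n (\<lambda>(i, j). A $$ (\<pi> i, \<pi> j))"
proof -
  have lt: "\<pi> i < n" if "i < n" for i
    using permutes_in_image[OF assms(1)] that by auto
  have QA: "Q * A = mat n n (\<lambda>(i, j). A $$ (\<pi> i, j))"
    using assms(2,3) lt
    by (intro eq_matI) (auto simp: scalar_prod_def if_distrib[of "\<lambda>x. x * _"] cong: if_cong)
  show ?thesis
    unfolding QA using assms(2,3) lt
    by (intro eq_matI) (auto simp: scalar_prod_def if_distrib[of "\<lambda>x. _ * x"] cong: if_cong)
qed

text \<open>Index \<open>i\<close> of \<open>A\<close> sits at position
  \<open>inv_into UNIV \<pi> i\<close> of the permuted matrix and takes its label and sign from
  there.\<close>

lemma signed_partition_permute:
  assumes "\<pi> permutes {..<n}" "A \<in> carrier_mat n n"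
    and "signed_partition n r f s (mat n n (\<lambda>(i, j). A $$ (\<pi> i, \<pi> j)))"
  shows "signed_partition n r (f \<circ> inv_into UNIV \<pi>) (s \<circ> inv_into UNIV \<pi>) A"
proof -
  have lt: "inv_into UNIV \<pi> i < n" if "i < n" for i
    using permutes_in_image[OF permutes_inv[OF assms(1)]] that by auto
  have \<pi>: "\<pi> (inv_into UNIV \<pi> i) = i" for i using permutes_inverses(1)[OF assms(1)] .
  have "(f \<circ> inv_into UNIV \<pi>) ` {..<n} = {..<r}"
    using assms(3) permutes_image[OF permutes_inv[OF assms(1)]]
    by (simp only: signed_partition_def image_comp[symmetric])
  moreover have "A $$ (i, j) = (if f (inv_into UNIV \<pi> i) = f (inv_into UNIV \<pi> j) then s (inv_into UNIV \<pi> i) * s (inv_into UNIV \<pi> j) else 0)"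
    if "i < n" "j < n" for i j
  proof -
    have "mat n n (\<lambda>(i, j). A $$ (\<pi> i, \<pi> j)) $$ (inv_into UNIV \<pi> i, inv_into UNIV \<pi> j) = A $$ (i, j)"
      using lt that by (simp add: \<pi>)
    then show ?thesis using assms(3) lt that unfolding signed_partition_def by metis
  qed
  ultimately show ?thesis using assms(2,3) lt by (auto simp: signed_partition_def)
qed

lemma signed_partition_block_diagonal:
  assumes pos: "\<forall>i<r. 0 < m i" and n: "n = (\<Sum>i<r. m i)"
    and b: "\<forall>i<r. b i \<in> carrier_vec (m i) \<and> set\<^sub>v (b i) \<subseteq> {-1, 1}"
  shows "\<exists>f s. signed_partition n r f s
    (diag_block_mat (map (\<lambda>i. outer_product (b i) (b i)) [0..<r]))"
proof -
  \<comment> \<open>The rows of the block matrix are enumerated as pairs of a block and an offset;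
    the label is then \<open>fst\<close>.\<close>
  define L where "L k = map (Pair k) [0..<m k]" for k
  define xs where "xs = concat (map L [0..<r])"
  define s where "s = (\<lambda>(k, i). b k $ i)"
  have xs: "set xs = (SIGMA k:{..<r}. {..<m k})"
    by (auto simp: xs_def L_def)
  have len: "length xs = n"
    by (simp add: xs_def L_def n length_concat o_def interv_sum_list_conv_sum_set_nat
        atLeast0LessThan)
  have "vec (length (L k)) (\<lambda>i. s (L k ! i)) = b k" if "k < r" for k
    using b that by (intro eq_vecI) (auto simp: L_def s_def)
  then have "map (\<lambda>i. outer_product (b i) (b i)) [0..<r]
    = map (\<lambda>k. outer_product (vec (length (L k)) (\<lambda>i. s (L k ! i)))
        (vec (length (L k)) (\<lambda>i. s (L k ! i)))) [0..<r]"
    by simp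
  moreover have "diag_block_mat \<dots> = mat n n (\<lambda>(i, j).
      if fst (xs ! i) = fst (xs ! j) then s (xs ! i) * s (xs ! j) else 0)"
    unfolding len[symmetric] xs_def
    by (rule diag_block_mat_outer_products) (auto simp: L_def)
  ultimately have D: "diag_block_mat (map (\<lambda>i. outer_product (b i) (b i)) [0..<r])
    = mat n n (\<lambda>(i, j). if fst (xs ! i) = fst (xs ! j) then s (xs ! i) * s (xs ! j) else 0)"
    by (rule trans[OF arg_cong[where f = diag_block_mat]])
  have "(\<lambda>i. fst (xs ! i)) ` {..<n} = fst ` set xs"
    using len by (auto simp: set_conv_nth)
  \<comment> \<open>Each label \<open>k\<close> occurs because block \<open>k\<close> is
    nonempty.\<close>
  also have "\<dots> = {..<r}" unfolding xs using pos by force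
  finally have "(\<lambda>i. fst (xs ! i)) ` {..<n} = {..<r}" .
  moreover have "s (xs ! i) \<in> {-1, 1}" if "i < n" for i
  proof -
    have "xs ! i \<in> (SIGMA k:{..<r}. {..<m k})" using that len xs nth_mem by metis
    then obtain k l where kl: "xs ! i = (k, l)" "k < r" "l < m k" by auto
    then have "b k $ l \<in> set\<^sub>v (b k)" using b by (auto simp: vec_set_def)
    then show ?thesis using kl b by (auto simp: s_def)
  qed
  ultimately have "signed_partition n r (\<lambda>i. fst (xs ! i)) (\<lambda>i. s (xs ! i))
    (diag_block_mat (map (\<lambda>i. outer_product (b i) (b i)) [0..<r]))"
    unfolding D signed_partition_def by auto
  then show ?thesis by blast
qed

text \<open>Listing the indices class by class gives the permutation; \<open>m\<close> collects the
  class sizes and \<open>b\<close> the signs within each class.\<close>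

lemma signed_partition_sort:
  assumes "signed_partition n r f s A"
  shows "\<exists>Q (m :: nat \<Rightarrow> nat) (b :: nat \<Rightarrow> real vec).
        permutation_matrix n Q \<and>
        (\<forall>i<r. 0 < m i) \<and> n = (\<Sum>i<r. m i) \<and>
        (\<forall>i<r. b i \<in> carrier_vec (m i) \<and> set\<^sub>v (b i) \<subseteq> {-1, 1}) \<and>
        Q * A * transpose_mat Q =
          diag_block_mat (map (\<lambda>i. outer_product (b i) (b i)) [0..<r])"
proof -
  have A: "A \<in> carrier_mat n n" and f: "f ` {..<n} = {..<r}"
    and s: "\<And>i. i < n \<Longrightarrow> s i \<in> {-1, 1}"
    and A_eq: "\<And>i j. i < n \<Longrightarrow> j < n \<Longrightarrow> A $$ (i, j) = (if f i = f j then s i * s j else 0)"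
    using assms by (auto simp: signed_partition_def)
  define L where "L k = filter (\<lambda>i. f i = k) [0..<n]" for k
  define xs where "xs = concat (map L [0..<r])"
  define m where "m k = length (L k)" for k
  define b where "b k = vec (m k) (\<lambda>i. s (L k ! i))" for k
  have L: "set (L k) = {i. i < n \<and> f i = k}" for k by (auto simp: L_def)
  have set_xs: "set xs = {..<n}" using f by (auto simp: xs_def L)
  \<comment> \<open>Distinctness of the concatenation needs pairwise distinct lists. Two empty
    classes would share the empty list, but every label is attained.\<close>
  have "inj_on L {..<r}"
  proof (rule inj_onI)
    fix k l assume "k \<in> {..<r}" "L k = L l"
    then obtain i where "i < n" "f i = k" using f by (metis imageE lessThan_iff)
    then have "i \<in> set (L k)" by (simp add: L)
    then show "k = l" using \<open>L k = L l\<close> by (metis (mono_tags, lifting) L mem_Collect_eq)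
  qed
  then have "distinct xs"
    unfolding xs_def
    by (intro distinct_concat) (auto simp: distinct_map L atLeast0LessThan, auto simp: L_def)
  have len: "length xs = n"
    using distinct_card[OF \<open>distinct xs\<close>] set_xs by simp
  \<comment> \<open>\<open>permutes\<close> demands the identity outside the index range.\<close>
  define \<pi> where "\<pi> i = (if i < n then xs ! i else i)" for i
  have "bij_betw ((!) xs) {..<n} {..<n}"
    using bij_betw_nth[OF \<open>distinct xs\<close>] len set_xs by simp
  then have "bij_betw \<pi> {..<n} {..<n}"
    by (rule bij_betw_cong[THEN iffD1, rotated]) (simp add: \<pi>_def)
  then have \<pi>: "\<pi> permutes {..<n}"
    by (rule bij_imp_permutes) (simp add: \<pi>_def)
  have xs_lt: "xs ! i < n" if "i < n" for i
    using that len set_xs nth_mem by (metis lessThan_iff)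
  define Q where "Q = mat n n (\<lambda>(i, j). if j = \<pi> i then 1 else (0::real))"
  have "diag_block_mat (map (\<lambda>i. outer_product (b i) (b i)) [0..<r])
    = mat n n (\<lambda>(i, j). if f (xs ! i) = f (xs ! j) then s (xs ! i) * s (xs ! j) else 0)"
    unfolding b_def m_def len[symmetric] xs_def
    by (rule diag_block_mat_outer_products) (auto simp: L)
  also have "\<dots> = mat n n (\<lambda>(i, j). A $$ (\<pi> i, \<pi> j))"
    by (intro eq_matI) (auto simp: \<pi>_def A_eq xs_lt)
  also have "\<dots> = Q * A * transpose_mat Q"
    using permutation_matrix_conj[OF \<pi> A Q_def] by simp
  finally have "Q * A * transpose_mat Q =
      diag_block_mat (map (\<lambda>i. outer_product (b i) (b i)) [0..<r])" ..
  moreover have "permutation_matrix n Q"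
    using \<pi> Q_def by (auto simp: permutation_matrix_def)
  moreover have "\<forall>i<r. 0 < m i"
  proof (intro allI impI)
    fix k assume "k < r"
    then obtain i where "i < n" "f i = k" using f by (metis imageE lessThan_iff)
    then have "i \<in> set (L k)" by (simp add: L)
    then show "0 < m k" by (auto simp: m_def dest: length_pos_if_in_set)
  qed
  moreover have "n = (\<Sum>i<r. m i)"
    using len by (simp add: xs_def m_def length_concat o_def interv_sum_list_conv_sum_set_nat
        atLeast0LessThan)
  moreover have "b k \<in> carrier_vec (m k) \<and> set\<^sub>v (b k) \<subseteq> {-1, 1}" for k
  proof -
    have "s (L k ! i) \<in> {-1, 1}" if "i < m k" for i
    proof (rule s)
      have "L k ! i \<in> set (L k)" using that by (simp add: m_def)
      then show "L k ! i < n" by (simp add: L)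
    qed
    then show ?thesis by (auto simp: b_def vec_set_def)
  qed
  ultimately show ?thesis by blast
qed

section \<open>From semidefiniteness to a signed partition\<close>

lemma positive_semidefinite_sym:
  assumes "X \<in> carrier_mat n n" "positive_semidefinite X" "p < n" "q < n"
  shows "X $$ (p, q) = X $$ (q, p)"
proof -
  have "transpose_mat X $$ (q, p) = X $$ (p, q)" using assms by simp
  then show ?thesis using assms(2) by (simp add: positive_semidefinite_def symmetric_matrix_def)
qed

lemma positive_semidefinite_proportional_cols:
  assumes X: "X \<in> carrier_mat n n" "positive_semidefinite X"
    and lt: "i < n" "j < n" "k < n"
    and diag: "X $$ (i, i) = 1" "X $$ (j, j) = 1" "X $$ (k, k) = 1"
    and ij: "(X $$ (i, j))\<^sup>2 = 1"
  shows "X $$ (k, i) = X $$ (i, j) * X $$ (k, j)"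
proof -
  note sym = positive_semidefinite_sym[OF X]
  define a where "a = X $$ (i, j)"
  define c where "c = X $$ (k, i) - a * X $$ (k, j)"
  \<comment> \<open>The vector e_i - a e_j is isotropic, so moving off it by c e_k leaves only the term -c^2.\<close>
  define v where "v = vec n (\<lambda>p. of_bool (p = i) - a * of_bool (p = j) - c * of_bool (p = k))"
  have v: "v \<in> carrier_vec n" by (simp add: v_def)
  \<comment> \<open>Since \<open>v\<close> is a combination of indicators, this also holds when
    \<open>k\<close> coincides with \<open>i\<close> or \<open>j\<close>. It evaluates both the
    inner and the outer sum of the quadratic form.\<close>
  have v_sum: "(\<Sum>p<n. v $ p * g p) = g i - a * g j - c * g k" for g
  proof -
    have "(\<Sum>p<n. v $ p * g p) = (\<Sum>p<n. (if p = i then g p else 0)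
        - a * (if p = j then g p else 0) - c * (if p = k then g p else 0))"
      by (rule sum.cong) (auto simp: v_def algebra_simps)
    then show ?thesis
      using lt by (simp add: sum_subtractf sum_distrib_left[symmetric])
  qed
  have "v \<bullet> (X *\<^sub>v v) = (\<Sum>p<n. v $ p * (\<Sum>q<n. v $ q * X $$ (p, q)))"
    unfolding scalar_prod_mult_mat_vec[OF X(1) v] by (simp add: sum_distrib_left mult_ac)
  \<comment> \<open>The cross terms with the direction \<open>k\<close> give -2c^2, and the unit
    diagonal entry at \<open>k\<close> returns c^2.\<close>
  also have "\<dots> = 1 - a\<^sup>2 - c\<^sup>2"
    unfolding v_sum using diag sym[OF lt(2,1)] sym[OF lt(1,3)] sym[OF lt(2,3)]
    by (simp add: a_def[symmetric] c_def power2_eq_square algebra_simps)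
  finally have "0 \<le> - c\<^sup>2"
    using X v ij unfolding positive_semidefinite_def a_def by auto
  then show ?thesis by (simp add: c_def a_def)
qed

lemma signed_partition_exists:
  assumes X: "X \<in> carrier_mat n n" "elements_mat X \<subseteq> {-1, 0, 1}"
    and diag: "diag_mat X = replicate n 1" and psd: "positive_semidefinite X"
  shows "\<exists>r f s. signed_partition n r f s X"
proof -
  have diag': "X $$ (i, i) = 1" if "i < n" for i
    using arg_cong[OF diag, of "\<lambda>xs. xs ! i"] X(1) that by (simp add: diag_mat_def)
  have sq: "X $$ (i, j) \<in> {-1, 1}" if "i < n" "j < n" "X $$ (i, j) \<noteq> 0" for i j
    using X that elements_matI[OF X(1), of i j] by auto
  have cols: "X $$ (k, i) = X $$ (i, j) * X $$ (k, j)"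
    if "i < n" "j < n" "k < n" "X $$ (i, j) \<noteq> 0" for i j k
    using that sq[of i j] by (intro positive_semidefinite_proportional_cols[OF X(1) psd])
      (auto simp: diag')
  note sym = positive_semidefinite_sym[OF X(1) psd]
  \<comment> \<open>The least index in the support of column \<open>i\<close> is a canonical
    representative of its class; the unit diagonal makes the support nonempty.\<close>
  define P where "P i = (LEAST j. j < n \<and> X $$ (j, i) \<noteq> 0)" for i
  have P: "P i < n" "X $$ (P i, i) \<noteq> 0" if "i < n" for i
    using LeastI[of "\<lambda>j. j < n \<and> X $$ (j, i) \<noteq> 0" i] that diag'[OF that]
    by (auto simp: P_def)
  \<comment> \<open>Columns that differ by a nonzero factor have the same support, hence the same
    least element.\<close>
  have P_eq: "P i = P j" if "i < n" "j < n" "X $$ (i, j) \<noteq> 0" for i j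
    unfolding P_def using cols[OF that(1,2) _ that(3)] that(3)
    by (metis (no_types, lifting) mult_eq_0_iff)
  \<comment> \<open>Representatives may be scattered, so \<open>g\<close> renumbers them to an
    initial segment.\<close>
  obtain g :: "nat \<Rightarrow> nat" where g: "bij_betw g (P ` {..<n}) {..<card (P ` {..<n})}"
    using ex_bij_betw_finite_nat[of "P ` {..<n}"] by (auto simp: atLeast0LessThan)
  define s where "s i = X $$ (P i, i)" for i
  have "(g \<circ> P) ` {..<n} = {..<card (P ` {..<n})}"
    using g by (simp add: bij_betw_def image_comp)
  moreover have "s i \<in> {-1, 1}" if "i < n" for i
    using sq P that by (simp add: s_def)
  moreover have "X $$ (i, j) = (if (g \<circ> P) i = (g \<circ> P) j then s i * s j else 0)"
    if ij: "i < n" "j < n" for i j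
  proof -
    have "(g \<circ> P) i = (g \<circ> P) j \<longleftrightarrow> P i = P j"
      using g ij by (auto simp: bij_betw_def inj_on_def)
    moreover have "X $$ (i, j) = s i * s j" if "P i = P j"
    proof -
      have nz: "X $$ (j, P j) \<noteq> 0" using P ij sym by metis
      \<comment> \<open>Column \<open>j\<close> is a multiple of the column of its representative,
        which is also the representative of \<open>i\<close>.\<close>
      have "X $$ (i, j) = X $$ (j, P j) * X $$ (i, P j)"
        by (rule cols) (use nz P ij in auto)
      also have "\<dots> = s j * s i"
        using that P ij sym[of j "P j"] sym[of i "P i"] by (simp add: s_def)
      finally show ?thesis by (simp only: mult.commute)
    qed
    ultimately show ?thesis using P_eq[OF ij] by auto
  qed
  ultimately have "signed_partition n (card (P ` {..<n})) (g \<circ> P) s X"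
    using X(1) unfolding signed_partition_def by blast
  then show ?thesis by blast
qed

theorem proposition4:
  fixes n r :: nat and X :: "real mat"
  assumes "X \<in> carrier_mat n n"
    and "elements_mat X \<subseteq> {-1, 0, 1}"
    and "symmetric_matrix X"
  shows
    "(diag_mat X = replicate n 1 \<and> vec_space.rank n X = r \<and> positive_semidefinite X)
     \<longleftrightarrow>
     (\<exists>Q (m :: nat \<Rightarrow> nat) (b :: nat \<Rightarrow> real vec).
        permutation_matrix n Q \<and>
        (\<forall>i<r. 0 < m i) \<and> n = (\<Sum>i<r. m i) \<and>
        (\<forall>i<r. b i \<in> carrier_vec (m i) \<and> set\<^sub>v (b i) \<subseteq> {-1, 1}) \<and>
        Q * X * transpose_mat Q =
          diag_block_mat (map (\<lambda>i. outer_product (b i) (b i)) [0..<r]))"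
  (is "?i \<longleftrightarrow> ?ii")
proof
  assume ?i
  then obtain k f s where "signed_partition n k f s X"
    using signed_partition_exists assms by blast
  \<comment> \<open>The number \<open>k\<close> of classes equals the rank, which is
    \<open>r\<close> by assumption.\<close>
  with signed_partition_rank \<open>?i\<close> have "signed_partition n r f s X" by blast
  then show ?ii by (rule signed_partition_sort)
next
  assume ?ii
  then obtain Q m b where Q: "permutation_matrix n Q" and m: "\<forall>i<r. 0 < m i" "n = (\<Sum>i<r. m i)"
    and b: "\<forall>i<r. b i \<in> carrier_vec (m i) \<and> set\<^sub>v (b i) \<subseteq> {-1, 1}"
    and D: "Q * X * transpose_mat Q =
      diag_block_mat (map (\<lambda>i. outer_product (b i) (b i)) [0..<r])"
    by blast
  obtain \<pi> where \<pi>: "\<pi> permutes {..<n}" "Q = mat n n (\<lambda>(i, j). if j = \<pi> i then 1 else 0)"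
    using Q by (auto simp: permutation_matrix_def)
  from signed_partition_block_diagonal[OF m b]
  obtain f s where "signed_partition n r f s (Q * X * transpose_mat Q)"
    unfolding D by blast
  then have "signed_partition n r (f \<circ> inv_into UNIV \<pi>) (s \<circ> inv_into UNIV \<pi>) X"
    unfolding permutation_matrix_conj[OF \<pi>(1) assms(1) \<pi>(2)]
    by (rule signed_partition_permute[OF \<pi>(1) assms(1)])
  then show ?i
    using signed_partition_diag signed_partition_rank signed_partition_positive_semidefinite
    by blast
qed

end
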